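(* Let $p(x)=x^4+ax^3+bx^2+cx+d$ be a monic real quartic polynomial, let $t_u=\frac{a^2}{16}-\frac b6-\frac1{16}(a^3-4ab+8c)^{2/3}$, and assume $t_u>0$. Denote its three critical points by $x_1<x_2<x_3$ (or $x_1>x_2>x_3$). If $p(x_1)<p(x_3)$, then $p(x_1^t,t)<p(x_3^t,t)$ for all $t\in[0,t_u)$.
   Context: Heat evolution of the quartic: $p(x,t)=x^4+ax^3+(b+6t)x^2+(c+3at)x+(d+bt+3t^2)$, i.e. the solution of $\frac{\partial p}{\partial t}=\frac12\frac{\partial^2p}{\partial x^2}$ with $p(x,0)=p(x)$. Here $y^{2/3}=(y^{1/3})^2$ with $y^{1/3}$ the real cube root. When $t_u>0$, for each $t\in[0,t_u)$ the polynomial $x\mapsto p(x,t)$ has exactly three distinct real critical points. They are denoted $x_1^t,x_2^t,x_3^t$, where $x_i^t$ depends continuously on $t$ with $x_i^0=x_i$ (so they keep the same order as $x_1,x_2,x_3$). *)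

theory Defs
  imports "HOL-Analysis.Analysis" "HOL-Computational_Algebra.Polynomial"
begin

definition quartic :: "real \<Rightarrow> real \<Rightarrow> real \<Rightarrow> real \<Rightarrow> real poly" where
  "quartic a b c d = [:d, c, b, a, 1:]"

text \<open>
  The heat evolution at time \<open>t\<close>, as a polynomial in \<open>x\<close>. The lemmas
  \<open>heat_quartic_0\<close> and \<open>heat_quartic_heat_equation\<close> confirm that it solves the
  heat equation with factor \<open>1/2\<close>, starting from the given quartic.
\<close>
definition heat_quartic :: "real \<Rightarrow> real \<Rightarrow> real \<Rightarrow> real \<Rightarrow> real \<Rightarrow> real poly" where
  "heat_quartic a b c d t = [:d + b * t + 3 * t\<^sup>2, c + 3 * a * t, b + 6 * t, a, 1:]"

lemma heat_quartic_0: "heat_quartic a b c d 0 = quartic a b c d"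
  by (simp add: heat_quartic_def quartic_def)

lemma heat_quartic_heat_equation:
  "((\<lambda>s. poly (heat_quartic a b c d s) x) has_real_derivative
     1 / 2 * poly (pderiv (pderiv (heat_quartic a b c d t))) x) (at t)"
  unfolding heat_quartic_def
  by (auto intro!: derivative_eq_intros simp: pderiv_pCons algebra_simps power2_eq_square)

text \<open>
  \<open>root 3\<close> is the real cube root, also for negative arguments; \<open>powr\<close> with
  exponent \<open>2/3\<close> would not be correct there.
\<close>
definition t_u :: "real \<Rightarrow> real \<Rightarrow> real \<Rightarrow> real" where
  "t_u a b c = a\<^sup>2 / 16 - b / 6 - 1 / 16 * (root 3 (a ^ 3 - 4 * a * b + 8 * c))\<^sup>2"

definition critical_points :: "real poly \<Rightarrow> real set" where
  "critical_points p = {x. poly (pderiv p) x = 0}"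

end

theory Submission
  imports Defs
begin

text \<open>
  If the critical points of a monic quartic with cubic coefficient \<open>a\<close> are \<open>u, v, w\<close>, then the
  values at \<open>w\<close> and \<open>u\<close> differ by \<open>(w - u)\<^sup>3 (v + a/4)\<close>, so the claim is that
  \<open>(X3 - X1) (X2 + a/4)\<close> stays positive. It is continuous in \<open>t\<close>, hence it suffices that it does
  not vanish. The first factor does not, because the critical points are distinct before \<open>t_u\<close>.
  The derivative of the heat evolution at the centre \<open>-a/4\<close> does not depend on \<open>t\<close>. So if the
  second factor vanished, \<open>-a/4\<close> would be a critical point already at \<open>t = 0\<close>; as the mean of the
  three critical points it would have to be the middle one, contradicting \<open>p(x1) \<noteq> p(x3)\<close>.
\<close>

lemma critical_points_heat_quartic_iff:
  "x \<in> critical_points (heat_quartic a b c d t) \<longleftrightarrow>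
     4 * x ^ 3 + 3 * a * x\<^sup>2 + 2 * (b + 6 * t) * x + (c + 3 * a * t) = 0"
  by (simp add: critical_points_def heat_quartic_def pderiv_pCons algebra_simps
      power2_eq_square power3_eq_cube)

text \<open>The cubic has its extrema at \<open>- m\<close> and \<open>m\<close>, with values
  \<open>s ^ 3 + 8 * m ^ 3\<close> and \<open>s ^ 3 - 8 * m ^ 3\<close>. The hypothesis gives them
  opposite signs. The cubic takes the same two values again at \<open>2 * m\<close> and
  \<open>- 2 * m\<close>, which bracket the outer roots.\<close>

lemma depressed_cubic_three_roots:
  fixes m s :: real
  assumes "\<bar>s\<bar> < 2 * m"
  obtains u v w where "u < v" "v < w"
    "4 * u ^ 3 - 12 * m\<^sup>2 * u + s ^ 3 = 0"
    "4 * v ^ 3 - 12 * m\<^sup>2 * v + s ^ 3 = 0"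
    "4 * w ^ 3 - 12 * m\<^sup>2 * w + s ^ 3 = 0"
proof -
  define f where "f y = 4 * y ^ 3 - 12 * m\<^sup>2 * y + s ^ 3" for y
  have m: "m > 0" using assms by linarith
  have "\<bar>s\<bar> ^ 3 < (2 * m) ^ 3"
    using assms by (intro power_strict_mono) auto
  then have s: "s ^ 3 < 8 * m ^ 3" "- (8 * m ^ 3) < s ^ 3"
    by (simp_all add: power_mult_distrib abs_less_iff flip: power_abs)
  have f_values: "f (- 2 * m) < 0" "f (- m) > 0" "f m < 0" "f (2 * m) > 0"
    using s by (simp_all add: f_def power2_eq_square power3_eq_cube algebra_simps)
  have cont: "continuous_on A f" for A
    unfolding f_def by (intro continuous_intros)
  obtain u where u: "u \<le> - m" "f u = 0"
    using IVT'[of f "- 2 * m" 0 "- m"] f_values m cont by force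
  obtain v where v: "- m \<le> v" "v \<le> m" "f v = 0"
    using IVT2'[of f m 0 "- m"] f_values m cont by force
  obtain w where w: "m \<le> w" "f w = 0"
    using IVT'[of f m 0 "2 * m"] f_values m cont by force
  have "u \<noteq> - m" "v \<noteq> - m" "v \<noteq> m" "w \<noteq> m"
    using u v w f_values by auto
  then have "u < v" "v < w" using u v w by linarith+
  then show thesis using that u v w unfolding f_def by blast
qed

text \<open>The shift \<open>x = y - a / 4\<close> turns the derivative into the depressed cubic
  above, with \<open>m\<^sup>2 = a\<^sup>2 / 16 - b / 6 - t\<close> and \<open>s ^ 3\<close> its
  constant term. In these terms \<open>t < t_u a b c\<close> reads
  \<open>s\<^sup>2 < (2 * m)\<^sup>2\<close>.\<close>

lemma heat_quartic_three_critical_points: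
  assumes "t < t_u a b c"
  obtains u v w where "u < v" "v < w" "{u, v, w} \<subseteq> critical_points (heat_quartic a b c d t)"
proof -
  define s where "s = root 3 (a ^ 3 - 4 * a * b + 8 * c) / 2"
  define m where "m = sqrt (a\<^sup>2 / 16 - b / 6 - t)"
  have s3: "s ^ 3 = (a ^ 3 - 4 * a * b + 8 * c) / 8"
    by (simp add: s_def power_divide odd_real_root_pow)
  have s2: "s\<^sup>2 / 4 < a\<^sup>2 / 16 - b / 6 - t"
    using assms by (simp add: t_u_def s_def power_divide)
  then have nonneg: "0 \<le> a\<^sup>2 / 16 - b / 6 - t"
    using zero_le_power2[of s] by linarith
  then have m2: "m\<^sup>2 = a\<^sup>2 / 16 - b / 6 - t"
    by (simp add: m_def)
  have "m \<ge> 0" using nonneg by (simp add: m_def)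
  moreover have "s\<^sup>2 < (2 * m)\<^sup>2" using s2 m2 by (simp add: power_mult_distrib)
  ultimately have "\<bar>s\<bar> < 2 * m"
    using power2_less_imp_less[of "\<bar>s\<bar>" "2 * m"] by simp
  then obtain u v w where "u < v" "v < w" and roots:
    "4 * u ^ 3 - 12 * m\<^sup>2 * u + s ^ 3 = 0"
    "4 * v ^ 3 - 12 * m\<^sup>2 * v + s ^ 3 = 0"
    "4 * w ^ 3 - 12 * m\<^sup>2 * w + s ^ 3 = 0"
    by (rule depressed_cubic_three_roots)
  have "y - a / 4 \<in> critical_points (heat_quartic a b c d t)"
    if "4 * y ^ 3 - 12 * m\<^sup>2 * y + s ^ 3 = 0" for y
    using that unfolding critical_points_heat_quartic_iff m2 s3
    by (simp add: field_simps power2_eq_square power3_eq_cube)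
  then show thesis
    using that[of "u - a / 4" "v - a / 4" "w - a / 4"] \<open>u < v\<close> \<open>v < w\<close> roots by auto
qed

lemma cubic_Vieta:
  fixes a b c u v w :: real
  assumes "4 * u ^ 3 + 3 * a * u\<^sup>2 + 2 * b * u + c = 0"
    and "4 * v ^ 3 + 3 * a * v\<^sup>2 + 2 * b * v + c = 0"
    and "4 * w ^ 3 + 3 * a * w\<^sup>2 + 2 * b * w + c = 0"
    and "u \<noteq> v" "v \<noteq> w" "u \<noteq> w"
  shows "3 * a = - 4 * (u + v + w)"
    and "b = 2 * (u * v + v * w + u * w)"
    and "c = - 4 * (u * v * w)"
proof -
  \<comment> \<open>Divided differences: subtracting two equations exposes a factor that is nonzero
    and cancels. Repeating this on the two quotients isolates the sum of the roots.\<close>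
  have "(u - v) * (4 * (u\<^sup>2 + u * v + v\<^sup>2) + 3 * a * (u + v) + 2 * b) = 0"
    using assms(1,2) by algebra
  then have uv: "4 * (u\<^sup>2 + u * v + v\<^sup>2) + 3 * a * (u + v) + 2 * b = 0"
    using assms(4) by simp
  have "(w - v) * (4 * (w\<^sup>2 + w * v + v\<^sup>2) + 3 * a * (w + v) + 2 * b) = 0"
    using assms(2,3) by algebra
  then have "4 * (w\<^sup>2 + w * v + v\<^sup>2) + 3 * a * (w + v) + 2 * b = 0"
    using assms(5) by simp
  with uv have "(u - w) * (4 * (u + v + w) + 3 * a) = 0" by algebra
  then show a: "3 * a = - 4 * (u + v + w)" using assms(6) by simp
  have "2 * b = 2 * (2 * (u * v + v * w + u * w))" using uv a by algebra
  then show b: "b = 2 * (u * v + v * w + u * w)" by simp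
  show "c = - 4 * (u * v * w)" using assms(1) a b by algebra
qed

lemma critical_points_heat_quartic_Vieta:
  assumes "critical_points (heat_quartic a b c d t) = {u, v, w}"
    and "u \<noteq> v" "v \<noteq> w" "u \<noteq> w"
  shows "3 * a = - 4 * (u + v + w)"
    and "b + 6 * t = 2 * (u * v + v * w + u * w)"
    and "c + 3 * a * t = - 4 * (u * v * w)"
proof -
  have "u \<in> critical_points (heat_quartic a b c d t)"
    "v \<in> critical_points (heat_quartic a b c d t)"
    "w \<in> critical_points (heat_quartic a b c d t)"
    using assms(1) by auto
  from this[unfolded critical_points_heat_quartic_iff]
  show "3 * a = - 4 * (u + v + w)"
    "b + 6 * t = 2 * (u * v + v * w + u * w)"
    "c + 3 * a * t = - 4 * (u * v * w)"
    using assms(2-4) by (rule cubic_Vieta)+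
qed

text \<open>Behind the formula is the integral of \<open>4 * (x - u) * (x - v) * (x - w)\<close>
  from \<open>u\<close> to \<open>w\<close>. By symmetry about the midpoint it equals
  \<open>2 / 3 * (w - u) ^ 3 * (v - (u + w) / 2)\<close>, and the sum of the roots rewrites the last
  factor as \<open>3 / 2 * (v + a / 4)\<close>. The proof itself is purely algebraic.\<close>

lemma heat_quartic_critical_value_diff:
  assumes "critical_points (heat_quartic a b c d t) = {u, v, w}"
    and "u \<noteq> v" "v \<noteq> w" "u \<noteq> w"
  shows "poly (heat_quartic a b c d t) w - poly (heat_quartic a b c d t) u =
           (w - u) ^ 3 * (v + a / 4)"
proof -
  note vieta = critical_points_heat_quartic_Vieta[OF assms]
  have "poly (heat_quartic a b c d t) w - poly (heat_quartic a b c d t) u =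
        (w ^ 4 - u ^ 4) + a * (w ^ 3 - u ^ 3) + (b + 6 * t) * (w\<^sup>2 - u\<^sup>2)
          + (c + 3 * a * t) * (w - u)"
    by (simp add: heat_quartic_def algebra_simps power2_eq_square power3_eq_cube
        power4_eq_xxxx)
  \<comment> \<open>The factor 12 clears the denominator 4 and lets \<open>a\<close> enter as
    \<open>3 * a\<close>, the form in which Vieta supplies it.\<close>
  then have "12 * (poly (heat_quartic a b c d t) w - poly (heat_quartic a b c d t) u) =
        (w - u) ^ 3 * (12 * v + 3 * a)"
    using vieta by algebra
  then show ?thesis by (simp add: algebra_simps)
qed

text \<open>The time-dependent part of the derivative is \<open>3 * t * (4 * x + a)\<close>, which
  vanishes at the centre.\<close>

lemma heat_quartic_centre_critical_iff:
  "- a / 4 \<in> critical_points (heat_quartic a b c d t) \<longleftrightarrow>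
   - a / 4 \<in> critical_points (heat_quartic a b c d t')"
  unfolding critical_points_heat_quartic_iff
  by (simp add: field_simps power2_eq_square power3_eq_cube)

lemma continuous_on_nonvanishing_pos:
  fixes h :: "real \<Rightarrow> real"
  assumes "continuous_on {0..<T} h" and "\<And>t. t \<in> {0..<T} \<Longrightarrow> h t \<noteq> 0"
    and "h 0 > 0" and "t \<in> {0..<T}"
  shows "h t > 0"
proof (rule ccontr)
  assume "\<not> h t > 0"
  moreover have "continuous_on {0..t} h"
    using assms(1,4) by (auto intro: continuous_on_subset)
  ultimately obtain x where "0 \<le> x" "x \<le> t" "h x = 0"
    using IVT2'[of h t 0 0] assms(3,4) by auto
  then show False using assms(2)[of x] assms(4) by auto
qed

theorem theorem4p6:
  fixes a b c d x1 x2 x3 :: real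
    and X1 X2 X3 :: "real \<Rightarrow> real"
  assumes "t_u a b c > 0"
    and "critical_points (quartic a b c d) = {x1, x2, x3}"
    and "(x1 < x2 \<and> x2 < x3) \<or> (x1 > x2 \<and> x2 > x3)"
    and "\<And>t. t \<in> {0..<t_u a b c} \<Longrightarrow>
           critical_points (heat_quartic a b c d t) = {X1 t, X2 t, X3 t}"
    and "continuous_on {0..<t_u a b c} X1"
    and "continuous_on {0..<t_u a b c} X2"
    and "continuous_on {0..<t_u a b c} X3"
    and "X1 0 = x1" and "X2 0 = x2" and "X3 0 = x3"
    and "poly (quartic a b c d) x1 < poly (quartic a b c d) x3"
  shows "\<forall>t\<in>{0..<t_u a b c}.
           poly (heat_quartic a b c d t) (X1 t) < poly (heat_quartic a b c d t) (X3 t)"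
proof
  let ?T = "t_u a b c"
  let ?h = "\<lambda>t. (X3 t - X1 t) * (X2 t + a / 4)"
  \<comment> \<open>A set listed by three terms that contains three different reals leaves no room
    for coincidences.\<close>
  have distinct: "X1 t \<noteq> X2 t" "X2 t \<noteq> X3 t" "X1 t \<noteq> X3 t" if t: "t \<in> {0..<?T}" for t
  proof -
    obtain u v w where "u < v" "v < w" "{u, v, w} \<subseteq> {X1 t, X2 t, X3 t}"
      using heat_quartic_three_critical_points[of t a b c d] assms(4)[OF t] t by auto
    then show "X1 t \<noteq> X2 t" "X2 t \<noteq> X3 t" "X1 t \<noteq> X3 t" by auto
  qed
  \<comment> \<open>Splitting off a square leaves \<open>?h t\<close> to carry the sign.\<close>
  have diff: "poly (heat_quartic a b c d t) (X3 t) - poly (heat_quartic a b c d t) (X1 t) =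
      (X3 t - X1 t)\<^sup>2 * ?h t" if "t \<in> {0..<?T}" for t
    using heat_quartic_critical_value_diff[OF assms(4)[OF that] distinct[OF that]]
    by (simp add: power2_eq_square power3_eq_cube mult.assoc)
  have zero: "0 \<in> {0..<?T}" using assms(1) by simp
  have "0 < (X3 0 - X1 0)\<^sup>2 * ?h 0"
    using diff[OF zero] assms(8,10,11) by (simp add: heat_quartic_0)
  then have h0: "?h 0 > 0" by (simp add: zero_less_mult_iff)
  have sum0: "3 * a = - 4 * (x1 + x2 + x3)"
    using critical_points_heat_quartic_Vieta(1)[OF assms(4)[OF zero] distinct[OF zero]]
      assms(8-10) by simp
  have "X2 t \<noteq> - a / 4" if t: "t \<in> {0..<?T}" for t
  proof
    assume "X2 t = - a / 4"
    then have "- a / 4 \<in> critical_points (heat_quartic a b c d t)"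
      using assms(4)[OF t] by simp
    then have "- a / 4 \<in> critical_points (heat_quartic a b c d 0)"
      using heat_quartic_centre_critical_iff by blast
    then have "- a / 4 \<in> {x1, x2, x3}"
      using assms(2) by (simp add: heat_quartic_0)
    then have "x2 = - a / 4" using sum0 assms(3) by auto
    then show False using h0 assms(9) by simp
  qed
  then have nonzero: "?h t \<noteq> 0" if "t \<in> {0..<?T}" for t
    using distinct(3)[OF that] that by (fastforce simp: eq_neg_iff_add_eq_0)
  have cont: "continuous_on {0..<?T} ?h"
    by (intro continuous_intros assms(5-7))
  fix t assume t: "t \<in> {0..<?T}"
  have "?h t > 0"
    using continuous_on_nonvanishing_pos[OF cont nonzero h0 t] .
  then have "(X3 t - X1 t)\<^sup>2 * ?h t > 0"
    using distinct(3)[OF t] by simp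
  then show "poly (heat_quartic a b c d t) (X1 t) < poly (heat_quartic a b c d t) (X3 t)"
    using diff[OF t] by linarith
qed

end
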